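(* Let $(\Omega_1,\mathscr{A}_1,\mu_1)$ and $(\Omega_2,\mathscr{A}_2,\mu_2)$ be two (potentially distinct) probability spaces. Let $(A_i)_{i\in\mathbb{N}}$ and $(B_i)_{i\in\mathbb{N}}$ be sequences of measurable sets in $\Omega_1$ and $\Omega_2$ respectively. Suppose $\mu_1(\limsup_{i\to\infty}A_i)=c$ with $0\le c\le1$. Furthermore, suppose that for any $k\in\mathbb{N}$ and indices $i_1,i_2,\dots,i_k\in\mathbb{N}$ we have \[\mu_1(A_{i_1}\cap A_{i_2}\cap\dots\cap A_{i_k})=\mu_2(B_{i_1}\cap B_{i_2}\cap\dots\cap B_{i_k}).\] Then $\mu_2(\limsup_{i\to\infty}B_i)=c$.
   Context: $\mathbb{N}=\{1,2,3,\dots\}$. For a sequence of sets $(A_i)_{i\in\mathbb{N}}$, $\limsup_{i\to\infty}A_i=\bigcap_{n\ge1}\bigcup_{i\ge n}A_i$ is the set of points lying in $A_i$ for infinitely many $i$. *)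

theory Defs
  imports "HOL-Probability.Probability"
begin

text \<open>
  For sequences of sets, the library's \<^const>\<open>limsup\<close>, taken in the complete lattice of sets, is
  the set of points that lie in infinitely many members. Its value does not depend on the
  member with index 0, so it also serves sequences indexed by the positive integers.
\<close>

lemma limsup_sets_from_one:
  fixes A :: "nat \<Rightarrow> 'a set"
  shows "limsup A = (\<Inter>n\<in>{1..}. \<Union>i\<in>{n..}. A i)"
proof -
  have "limsup A = (\<Inter>n. \<Union>i\<in>{n..}. A i)"
    by (simp add: limsup_INF_SUP)
  also have "\<dots> = (\<Inter>n\<in>{1..}. \<Union>i\<in>{n..}. A i)"
  proof (intro subset_antisym subsetI)
    fix x assume "x \<in> (\<Inter>n. \<Union>i\<in>{n..}. A i)"
    then show "x \<in> (\<Inter>n\<in>{1..}. \<Union>i\<in>{n..}. A i)" by blast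
  next
    fix x assume x: "x \<in> (\<Inter>n\<in>{1..}. \<Union>i\<in>{n..}. A i)"
    have "\<exists>i\<ge>n. x \<in> A i" for n
    proof -
      have "x \<in> (\<Union>i\<in>{Suc n..}. A i)" using x by auto
      then show ?thesis by (auto intro: Suc_leD)
    qed
    then show "x \<in> (\<Inter>n. \<Union>i\<in>{n..}. A i)" by auto
  qed
  finally show ?thesis .
qed

end

theory Submission
  imports Defs
begin

text \<open>
  The measure of a limsup set is determined by the measures of the finite intersections.
  By inclusion-exclusion, the finite intersections determine the measure of every finite union
  (\<open>measure_finite_UN_eq\<close>).  The rest is continuity of a finite measure, used twice: the
  tail union over \<open>i \<ge> n\<close> is an increasing limit of finite unions, and the limsup is the
  decreasing limit of the tail unions (\<open>measure_limsup_as_iterated_limit\<close>).  Hence the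
  measure of the limsup is an iterated limit of measures of finite unions, and two sequences of
  events with the same finite-intersection measures have the same iterated limit.
\<close>

text \<open>
  Inclusion-exclusion without its alternating sum: deleting one more event \<open>A i\<close> from an atom
  subtracts the mass of the atom in which \<open>A i\<close> is instead required, so induction on the set of
  deleted events reduces every atom to intersections.  The set of required events grows along
  the way and is therefore arbitrary in the induction.  Intersecting with the space gives an
  empty \<open>J\<close> its correct meaning.
\<close>

lemma measure_atom_eq:
  assumes M: "finite_measure M" and N: "finite_measure N"
    and A: "\<And>i. i \<in> K \<Longrightarrow> A i \<in> sets M" and B: "\<And>i. i \<in> K \<Longrightarrow> B i \<in> sets N"
    and inter: "\<And>J. finite J \<Longrightarrow> J \<subseteq> K \<Longrightarrow>
      measure M (space M \<inter> (\<Inter>j\<in>J. A j)) = measure N (space N \<inter> (\<Inter>j\<in>J. B j))"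
    and "finite I" "I \<subseteq> K" "finite J" "J \<subseteq> K"
  shows "measure M (space M \<inter> (\<Inter>j\<in>J. A j) - (\<Union>i\<in>I. A i))
       = measure N (space N \<inter> (\<Inter>j\<in>J. B j) - (\<Union>i\<in>I. B i))"
  using \<open>finite I\<close> \<open>I \<subseteq> K\<close> \<open>finite J\<close> \<open>J \<subseteq> K\<close>
proof (induction I arbitrary: J rule: finite_induct)
  case empty
  then show ?case using inter by simp
next
  case (insert i I)
  have step: "measure P (space P \<inter> (\<Inter>j\<in>J. C j) - (\<Union>k\<in>insert i I. C k))
      = measure P (space P \<inter> (\<Inter>j\<in>J. C j) - (\<Union>k\<in>I. C k))
        - measure P (space P \<inter> (\<Inter>j\<in>insert i J. C j) - (\<Union>k\<in>I. C k))"
    if P: "finite_measure P" and C: "\<forall>k\<in>K. C k \<in> sets P"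
    for P :: "'z measure" and C
  proof -
    interpret finite_measure P by fact
    have atom: "space P \<inter> (\<Inter>j\<in>L. C j) - (\<Union>k\<in>I. C k) \<in> sets P"
      if "finite L" "L \<subseteq> K" for L
    proof -
      have "space P \<inter> (\<Inter>j\<in>L. C j) = {x \<in> space P. \<forall>j\<in>L. x \<in> C j}" by auto
      also have "\<dots> \<in> sets P"
        using that C by (intro sets.sets_Collect_finite_All) (auto intro: sets.sets_Collect)
      finally show ?thesis
        using insert.hyps insert.prems C by (intro sets.Diff sets.finite_UN) auto
    qed
    have "space P \<inter> (\<Inter>j\<in>J. C j) - (\<Union>k\<in>insert i I. C k)
        = (space P \<inter> (\<Inter>j\<in>J. C j) - (\<Union>k\<in>I. C k))
          - (space P \<inter> (\<Inter>j\<in>insert i J. C j) - (\<Union>k\<in>I. C k))"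
      by auto
    then show ?thesis
      using insert.prems atom[of J] atom[of "insert i J"]
      by (simp only:) (rule finite_measure_Diff, auto)
  qed
  have sets_A: "\<forall>k\<in>K. A k \<in> sets M" and sets_B: "\<forall>k\<in>K. B k \<in> sets N"
    using A B by blast+
  show ?case
    unfolding step[OF M sets_A] step[OF N sets_B]
    using insert.IH[of J] insert.IH[of "insert i J"] insert.prems by simp
qed

text \<open>
  The empty intersection supplies equality of the total masses, so the claim for unions follows
  from that for their complements.
\<close>

lemma measure_finite_UN_eq:
  assumes M: "finite_measure M" and N: "finite_measure N"
    and A: "\<And>i. i \<in> K \<Longrightarrow> A i \<in> sets M" and B: "\<And>i. i \<in> K \<Longrightarrow> B i \<in> sets N"
    and inter: "\<And>J. finite J \<Longrightarrow> J \<subseteq> K \<Longrightarrow>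
      measure M (space M \<inter> (\<Inter>j\<in>J. A j)) = measure N (space N \<inter> (\<Inter>j\<in>J. B j))"
    and I: "finite I" "I \<subseteq> K"
  shows "measure M (\<Union>i\<in>I. A i) = measure N (\<Union>i\<in>I. B i)"
proof -
  have "measure M (space M - (\<Union>i\<in>I. A i)) = measure N (space N - (\<Union>i\<in>I. B i))"
    using measure_atom_eq[OF M N A B inter I, of "{}"] by simp
  moreover have "measure M (space M) = measure N (space N)"
    using inter[of "{}"] by simp
  moreover have "(\<Union>i\<in>I. A i) \<in> sets M" "(\<Union>i\<in>I. B i) \<in> sets N"
    using I A B by (auto intro!: sets.finite_UN)
  ultimately show ?thesis
    by (simp add: finite_measure.finite_measure_compl[OF M] finite_measure.finite_measure_compl[OF N])
qed

text \<open>
  The left-hand side mentions only finite unions, so it agrees for any two sequences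
  whose finite unions have equal measures.  Tails start at \<open>Suc n\<close> because \<open>A 0\<close> may fail
  to be measurable.
\<close>

lemma measure_limsup_as_iterated_limit:
  assumes M: "finite_measure M" and A: "\<And>i. 1 \<le> i \<Longrightarrow> A i \<in> sets M"
  shows "(\<lambda>n. lim (\<lambda>m. measure M (\<Union>i\<in>{Suc n..m}. A i))) \<longlonglongrightarrow> measure M (limsup A)"
proof -
  interpret finite_measure M by fact
  have tail: "(\<lambda>m. measure M (\<Union>i\<in>{Suc n..m}. A i)) \<longlonglongrightarrow> measure M (\<Union>i\<in>{Suc n..}. A i)" for n
  proof -
    have "(\<lambda>m. measure M (\<Union>i\<in>{Suc n..m}. A i)) \<longlonglongrightarrow> measure M (\<Union>m. \<Union>i\<in>{Suc n..m}. A i)"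
      using A by (intro finite_Lim_measure_incseq) (auto simp: incseq_def, fastforce)
    also have "(\<Union>m. \<Union>i\<in>{Suc n..m}. A i) = (\<Union>i\<in>{Suc n..}. A i)"
      by force
    finally show ?thesis .
  qed
  have shift: "{1..} = range Suc"
    by (auto simp: image_iff Suc_le_eq gr0_conv_Suc)
  have "(\<lambda>n. measure M (\<Union>i\<in>{Suc n..}. A i)) \<longlonglongrightarrow> measure M (\<Inter>n. \<Union>i\<in>{Suc n..}. A i)"
  proof (rule finite_Lim_measure_decseq)
    show "range (\<lambda>n. \<Union>i\<in>{Suc n..}. A i) \<subseteq> sets M"
      using A by auto
    show "decseq (\<lambda>n. \<Union>i\<in>{Suc n..}. A i)"
      by (intro decseq_SucI UN_mono) auto
  qed
  also have "(\<Inter>n. \<Union>i\<in>{Suc n..}. A i) = limsup A"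
    unfolding limsup_sets_from_one by (simp only: shift image_image)
  finally show ?thesis
    by (simp only: tail[THEN limI])
qed

theorem theorem1p3:
  fixes M1 :: "'a measure" and M2 :: "'b measure"
    and A :: "nat \<Rightarrow> 'a set" and B :: "nat \<Rightarrow> 'b set"
    and c :: real
  assumes "prob_space M1" and "prob_space M2"
    and "\<And>i. 1 \<le> i \<Longrightarrow> A i \<in> sets M1"
    and "\<And>i. 1 \<le> i \<Longrightarrow> B i \<in> sets M2"
    and "0 \<le> c" and "c \<le> 1"
    and "measure M1 (limsup A) = c"
    and "\<And>(k :: nat) (i :: nat \<Rightarrow> nat). 1 \<le> k \<Longrightarrow> (\<forall>j\<in>{1..k}. 1 \<le> i j) \<Longrightarrow>
           measure M1 (\<Inter>j\<in>{1..k}. A (i j)) = measure M2 (\<Inter>j\<in>{1..k}. B (i j))"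
  shows "measure M2 (limsup B) = c"
proof -
  interpret M1: prob_space M1 by fact
  interpret M2: prob_space M2 by fact
  have inter: "measure M1 (space M1 \<inter> (\<Inter>j\<in>J. A j)) = measure M2 (space M2 \<inter> (\<Inter>j\<in>J. B j))"
    if J: "finite J" "J \<subseteq> {1..}" for J
  proof (cases "J = {}")
    case True
    \<comment> \<open>The hypothesis covers only nonempty intersections; the empty one is the total mass 1.\<close>
    then show ?thesis by (simp add: M1.prob_space M2.prob_space)
  next
    case False
    obtain i where "bij_betw i {1..card J} J"
      using ex_bij_betw_nat_finite_1[OF J(1)] by blast
    then have i: "i ` {1..card J} = J" by (rule bij_betw_imp_surj_on)
    have "1 \<le> card J" using J(1) False by (simp add: Suc_le_eq card_gt_0_iff)
    moreover have "\<forall>j\<in>{1..card J}. 1 \<le> i j" using i J(2) by auto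
    ultimately have "measure M1 (\<Inter>j\<in>{1..card J}. A (i j)) = measure M2 (\<Inter>j\<in>{1..card J}. B (i j))"
      by (rule assms(8))
    then have "measure M1 (\<Inter>j\<in>J. A j) = measure M2 (\<Inter>j\<in>J. B j)"
      by (subst (1 2) i[symmetric]) (simp only: image_image)
    moreover have "(\<Inter>j\<in>J. A j) \<subseteq> space M1" "(\<Inter>j\<in>J. B j) \<subseteq> space M2"
      using False J(2) assms(3,4)[THEN sets.sets_into_space] by fastforce+
    ultimately show ?thesis by (simp add: Int_absorb1)
  qed
  have "measure M1 (\<Union>i\<in>{Suc n..m}. A i) = measure M2 (\<Union>i\<in>{Suc n..m}. B i)" for n m
    by (rule measure_finite_UN_eq[where K = "{1..}"])
       (use assms(3,4) inter M1.finite_measure_axioms M2.finite_measure_axioms in auto)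
  then have "(\<lambda>n. lim (\<lambda>m. measure M2 (\<Union>i\<in>{Suc n..m}. B i))) \<longlonglongrightarrow> measure M1 (limsup A)"
    using measure_limsup_as_iterated_limit[of M1 A, OF M1.finite_measure_axioms assms(3)] by simp
  moreover have "(\<lambda>n. lim (\<lambda>m. measure M2 (\<Union>i\<in>{Suc n..m}. B i))) \<longlonglongrightarrow> measure M2 (limsup B)"
    by (rule measure_limsup_as_iterated_limit[of M2 B, OF M2.finite_measure_axioms assms(4)])
  ultimately show ?thesis
    using LIMSEQ_unique assms(7) by blast
qed

end
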